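(* For $n\ge 1$ let $A_n(x)=\sum_{k=1}^n a_{n,k}x^{k-1}$ with $$a_{n,k}=\frac{1}{n!}\binom{n}{k}\left(H_n-H_{n-k}\right),\qquad H_m=\sum_{i=1}^m\frac1i\ (H_0=0).$$ Then $A_n$ is logconcave: $a_{n,k}^2\ge a_{n,k-1}a_{n,k+1}$ for all $2\le k\le n-1$. *)

theory Defs
  imports "HOL-Analysis.Harmonic_Numbers" "HOL-Computational_Algebra.Polynomial"
begin

text \<open>
  The harmonic numbers are the library's \<^const>\<open>harm\<close>. The natural-number subtraction
  \<open>n - k\<close> is only meaningful for \<open>k \<le> n\<close>; this covers all uses below.
\<close>

definition a_coeff :: "nat \<Rightarrow> nat \<Rightarrow> real" where
  "a_coeff n k = 1 / fact n * real (n choose k) * (harm n - harm (n - k))"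

definition A_poly :: "nat \<Rightarrow> real poly" where
  "A_poly n = (\<Sum>k = 1..n. monom (a_coeff n k) (k - 1))"

text \<open>
  Log-concavity of the coefficient sequence, i.e. the inequality at every interior index
  \<open>0 < j < degree p\<close>; it is not log-concavity of \<open>p\<close> as a real function.
\<close>

definition logconcave_poly :: "real poly \<Rightarrow> bool" where
  "logconcave_poly p \<longleftrightarrow>
     (\<forall>j. 0 < j \<and> j < degree p \<longrightarrow> (coeff p j)\<^sup>2 \<ge> coeff p (j - 1) * coeff p (j + 1))"

end

theory Submission
  imports Defs
begin

text \<open>
  Put \<open>m = n - k\<close> and \<open>D = harm n - harm m\<close>. Since the ratio of \<open>(n choose k)\<^sup>2\<close> to the product of
  its neighbours is \<open>(k + 1) * (m + 1) / (k * m)\<close>, the claim becomes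
  \<open>(k + m + 1) * (m + 1) * D\<^sup>2 - k * D + k \<ge> 0\<close>, a quadratic in \<open>D\<close> that is nonnegative for every
  real \<open>D\<close>. Beyond \<open>harm (m + 1) = harm m + 1 / (m + 1)\<close>, nothing about harmonic numbers is needed.
\<close>

text \<open>Splitting off \<open>k * (D\<^sup>2 - D + 1)\<close>, whose second factor has negative
  discriminant, leaves only a nonnegative multiple of \<open>D\<^sup>2\<close>.\<close>

lemma quadratic_nonneg:
  fixes k m D :: real
  assumes "k \<ge> 0" "m \<ge> 0"
  shows "(k + m + 1) * (m + 1) * D\<^sup>2 - k * D + k \<ge> 0"
proof -
  have "D\<^sup>2 - D + 1 = (D - 1 / 2)\<^sup>2 + 3 / 4"
    by (simp add: power2_eq_square algebra_simps)
  then have "k * (D\<^sup>2 - D + 1) \<ge> 0"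
    using assms by simp
  moreover have "(k * m + (m + 1) * (m + 1)) * D\<^sup>2 \<ge> 0"
    using assms by simp
  ultimately show ?thesis
    by (simp add: algebra_simps)
qed

lemma a_coeff_logconcave:
  assumes "2 \<le> k" "k \<le> n - 1"
  shows "a_coeff n (k - 1) * a_coeff n (k + 1) \<le> (a_coeff n k)\<^sup>2"
proof -
  obtain i where k: "k = Suc i"
    using assms by (cases k) auto
  \<comment> \<open>Writing the difference as \<open>Suc l\<close> gives \<open>n - k > 0\<close>,
    so the division by \<open>M\<close> in \<open>Dp\<close> is legitimate.\<close>
  obtain l where n: "n = k + Suc l"
    using assms less_imp_Suc_add[of k n] by fastforce
  define B where "B = real (n choose k)"
  define D where "D = harm n - (harm (n - k) :: real)"
  define M where "M = real (n - k)"
  define K where "K = real k"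
  have pos: "M > 0" "K > 0"
    unfolding M_def K_def using n k by auto
  have "n - i = n - k + 1"
    using n k by simp
  \<comment> \<open>Both sides equal \<open>n * ((n - 1) choose i)\<close>.\<close>
  then have "k * (n choose k) = (n - k + 1) * (n choose (k - 1))"
    using binomial_absorb_comp[of n i] binomial_absorption[of i n] k by simp
  then have "K * B = (M + 1) * real (n choose (k - 1))"
    unfolding K_def B_def M_def by (metis of_nat_1 of_nat_add of_nat_mult)
  then have Bm: "real (n choose (k - 1)) = K * B / (M + 1)"
    using pos by (simp add: field_simps)
  have "(k + 1) * (n choose (k + 1)) = (n - k) * (n choose k)"
    using binomial_absorb_comp[of n k] binomial_absorption[of k n] by simp
  then have "(K + 1) * real (n choose (k + 1)) = M * B"
    unfolding K_def B_def M_def by (metis of_nat_1 of_nat_add of_nat_mult)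
  then have Bp: "real (n choose (k + 1)) = M * B / (K + 1)"
    using pos by (simp add: field_simps)
  have "n - (k - 1) = Suc (n - k)" "n - k = Suc (n - (k + 1))"
    using n k by auto
  then have "harm (n - (k - 1)) = harm (n - k) + (1 / (M + 1) :: real)"
    and "harm (n - k) = harm (n - (k + 1)) + (1 / M :: real)"
    unfolding M_def by (simp_all add: harm_Suc inverse_eq_divide add.commute)
  then have Dm: "harm n - harm (n - (k - 1)) = D - 1 / (M + 1)"
    and Dp: "harm n - harm (n - (k + 1)) = D + 1 / M"
    unfolding D_def by simp_all
  \<comment> \<open>Since \<open>1 / M - 1 / (M + 1) = 1 / (M * (M + 1))\<close>, the product of the
    two shifted factors is \<open>D\<^sup>2 + (D - 1) / (M * (M + 1))\<close>; hence the terms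
    \<open>- K * D + K\<close> in the numerator.\<close>
  have "D\<^sup>2 - K * M / ((M + 1) * (K + 1)) * ((D - 1 / (M + 1)) * (D + 1 / M))
      = ((K + M + 1) * (M + 1) * D\<^sup>2 - K * D + K) / ((M + 1)\<^sup>2 * (K + 1))"
    using pos by (simp add: divide_simps) (simp add: power2_eq_square algebra_simps)
  also have "\<dots> \<ge> 0"
    using quadratic_nonneg[of K M D] pos by simp
  finally have "K * M / ((M + 1) * (K + 1)) * ((D - 1 / (M + 1)) * (D + 1 / M)) \<le> D\<^sup>2"
    by simp
  then have "(B / fact n)\<^sup>2 * (K * M / ((M + 1) * (K + 1)) * ((D - 1 / (M + 1)) * (D + 1 / M)))
      \<le> (B / fact n)\<^sup>2 * D\<^sup>2"
    by (intro mult_left_mono) auto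
  moreover have "a_coeff n (k - 1) * a_coeff n (k + 1) =
      (B / fact n)\<^sup>2 * (K * M / ((M + 1) * (K + 1)) * ((D - 1 / (M + 1)) * (D + 1 / M)))"
    unfolding a_coeff_def Bm Bp Dm Dp by (simp add: power2_eq_square mult_ac)
  moreover have "(a_coeff n k)\<^sup>2 = (B / fact n)\<^sup>2 * D\<^sup>2"
    unfolding a_coeff_def B_def D_def by (simp add: power_mult_distrib power_divide)
  ultimately show ?thesis
    by simp
qed

lemma coeff_A_poly: "coeff (A_poly n) j = (if j < n then a_coeff n (Suc j) else 0)"
proof -
  have "A_poly n = (\<Sum>i<n. monom (a_coeff n (Suc i)) i)"
    unfolding A_poly_def by (rule sum.reindex_bij_witness[of _ Suc "\<lambda>k. k - 1"]) auto
  then show ?thesis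
    by (simp add: coeff_sum)
qed

text \<open>This confines the interior indices \<open>j\<close> in \<open>logconcave_poly\<close> to
  \<open>Suc j \<le> n - 1\<close>.\<close>

lemma degree_A_poly_le: "degree (A_poly n) \<le> n - 1"
  by (rule degree_le) (auto simp: coeff_A_poly)

theorem theorem4p1:
  fixes n :: nat
  assumes "n \<ge> 1"
  shows "logconcave_poly (A_poly n) \<and>
    (\<forall>k. 2 \<le> k \<and> k \<le> n - 1 \<longrightarrow>
      (a_coeff n k)\<^sup>2 \<ge> a_coeff n (k - 1) * a_coeff n (k + 1))"
proof (intro conjI allI impI)
  show "logconcave_poly (A_poly n)"
    unfolding logconcave_poly_def
  proof (intro allI impI)
    fix j assume j: "0 < j \<and> j < degree (A_poly n)"
    \<comment> \<open>The coefficient at \<open>j\<close> is \<open>a_coeff n (Suc j)\<close>, so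
      the interior index \<open>j\<close> corresponds to \<open>k = Suc j\<close>.\<close>
    then have "2 \<le> Suc j" "Suc j \<le> n - 1"
      using degree_A_poly_le[of n] by auto
    then show "coeff (A_poly n) (j - 1) * coeff (A_poly n) (j + 1) \<le> (coeff (A_poly n) j)\<^sup>2"
      using a_coeff_logconcave[of "Suc j" n] j by (auto simp: coeff_A_poly)
  qed
qed (use a_coeff_logconcave in auto)

end
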